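(* Let $x_1,\dots,x_n\in\mathbb{R}^{d+1}$, $x_i=(1,x_{i1},\dots,x_{id})$. An optimal parameter $\beta^*\in\mathbb{R}^{d}$ that minimizes $\Phi_{LSS}$ can be obtained by solving any of the following two problems: $$(\mathrm{LSS}_{\mathrm{QP}})\qquad \min\Big\{\sum_{i=1}^n z_i^2:\ z_i\ge x_{id}-\sum_{k=1}^{d-1}\beta_kx_{ik}-\beta_0\ (i=1,\dots,n),\ \beta\in\mathbb{R}^d,\ z\in\mathbb{R}^n_+\Big\},$$ $$(\mathrm{LSS}_{\mathrm{SOCP}})\qquad \min\Big\{\sum_{i=1}^n w_i:\ w_i\ge\Big(x_{id}-\sum_{k=1}^{d-1}\beta_kx_{ik}-\beta_0\Big)^2\ (i=1,\dots,n),\ \beta\in\mathbb{R}^d,\ w\in\mathbb{R}^n_+\Big\}.$$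
   Context: $\beta=(\beta_0,\dots,\beta_{d-1})$. $\Phi_{LSS}=\sum_{i=1}^n\varepsilon_i^2$ is the least sum of squares criterion, where the residuals are the vertical distances with respect to the last coordinate, with the coefficient of the last coordinate normalized to $\beta_d=1$: $\varepsilon_i=\big|x_{id}-\sum_{k=1}^{d-1}\beta_kx_{ik}-\beta_0\big|$.
   Formalization: In (LSS_QP) each z_i is bounded below by both the signed residual and its negative (z_i ≥ ε_i); the printed one-sided constraint fails, e.g. d=1, x_{11}=0, x_{21}=1: optimum z=0 exactly for β_0 ≥ 1, but LSS is minimized only at β_0=1/2. *)

theory Defs
  imports Complex_Main "HOL-Library.FuncSet"
begin

text \<open>
  Points and parameters are functions on explicit index sets, extensional outside of them, so that
  \<open>{0..<d} \<rightarrow>\<^sub>E UNIV\<close> is \<open>\<real>\<^sup>d\<close> with coordinates \<open>0, \<dots>, d - 1\<close>.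
\<close>

definition params :: "nat \<Rightarrow> (nat \<Rightarrow> real) set" where
  "params d = {0..<d} \<rightarrow>\<^sub>E UNIV"

definition signed_residual :: "nat \<Rightarrow> (nat \<Rightarrow> nat \<Rightarrow> real) \<Rightarrow> (nat \<Rightarrow> real) \<Rightarrow> nat \<Rightarrow> real" where
  "signed_residual d x \<beta> i = x i d - (\<Sum>k\<in>{1..<d}. \<beta> k * x i k) - \<beta> 0"

definition residual :: "nat \<Rightarrow> (nat \<Rightarrow> nat \<Rightarrow> real) \<Rightarrow> (nat \<Rightarrow> real) \<Rightarrow> nat \<Rightarrow> real" where
  "residual d x \<beta> i = \<bar>signed_residual d x \<beta> i\<bar>"

definition LSS :: "nat \<Rightarrow> nat \<Rightarrow> (nat \<Rightarrow> nat \<Rightarrow> real) \<Rightarrow> (nat \<Rightarrow> real) \<Rightarrow> real" where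
  "LSS n d x \<beta> = (\<Sum>i\<in>{1..n}. (residual d x \<beta> i)\<^sup>2)"

definition LSS_minimizer :: "nat \<Rightarrow> nat \<Rightarrow> (nat \<Rightarrow> nat \<Rightarrow> real) \<Rightarrow> (nat \<Rightarrow> real) \<Rightarrow> bool" where
  "LSS_minimizer n d x \<beta> \<longleftrightarrow> is_arg_min (LSS n d x) (\<lambda>\<beta>. \<beta> \<in> params d) \<beta>"

text \<open>
  The slack variables bound the residual from both sides. The constraint
  \<open>z i \<ge> signed_residual d x \<beta> i\<close> alone would leave negative signed residuals unpenalized:
  a large \<open>\<beta> 0\<close> would make \<open>z = 0\<close> feasible, whatever the data.
\<close>

definition QP_feasible ::
  "nat \<Rightarrow> nat \<Rightarrow> (nat \<Rightarrow> nat \<Rightarrow> real) \<Rightarrow> (nat \<Rightarrow> real) \<times> (nat \<Rightarrow> real) \<Rightarrow> bool" where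
  "QP_feasible n d x = (\<lambda>(\<beta>, z). \<beta> \<in> params d \<and> z \<in> {1..n} \<rightarrow>\<^sub>E {0..} \<and>
     (\<forall>i\<in>{1..n}. z i \<ge> signed_residual d x \<beta> i \<and> z i \<ge> - signed_residual d x \<beta> i))"

definition QP_optimal ::
  "nat \<Rightarrow> nat \<Rightarrow> (nat \<Rightarrow> nat \<Rightarrow> real) \<Rightarrow> (nat \<Rightarrow> real) \<times> (nat \<Rightarrow> real) \<Rightarrow> bool" where
  "QP_optimal n d x = is_arg_min (\<lambda>(\<beta>, z). \<Sum>i\<in>{1..n}. (z i)\<^sup>2) (QP_feasible n d x)"

definition SOCP_feasible ::
  "nat \<Rightarrow> nat \<Rightarrow> (nat \<Rightarrow> nat \<Rightarrow> real) \<Rightarrow> (nat \<Rightarrow> real) \<times> (nat \<Rightarrow> real) \<Rightarrow> bool" where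
  "SOCP_feasible n d x = (\<lambda>(\<beta>, w). \<beta> \<in> params d \<and> w \<in> {1..n} \<rightarrow>\<^sub>E {0..} \<and>
     (\<forall>i\<in>{1..n}. w i \<ge> (signed_residual d x \<beta> i)\<^sup>2))"

definition SOCP_optimal ::
  "nat \<Rightarrow> nat \<Rightarrow> (nat \<Rightarrow> nat \<Rightarrow> real) \<Rightarrow> (nat \<Rightarrow> real) \<times> (nat \<Rightarrow> real) \<Rightarrow> bool" where
  "SOCP_optimal n d x = is_arg_min (\<lambda>(\<beta>, w). \<Sum>i\<in>{1..n}. w i) (SOCP_feasible n d x)"

end

theory Submission
  imports Defs
begin

text \<open>
  A least squares minimizer exists because the normal equations are solvable; adding the regressors
  one at a time, as in Gram-Schmidt orthogonalization, gives a solution without any compactness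
  argument or rank assumption. Both problems are epigraph reformulations of least squares: the
  objective dominates \<open>LSS\<close> on the feasible set, with equality when every slack is tight.
\<close>

text \<open>Induction on \<open>K\<close>: the error of the old fit is corrected along the part of
  the new regressor that is orthogonal to the old ones. \<open>b\<close> is arbitrary because the
  hypothesis is used for two targets.\<close>

lemma normal_equations_solvable:
  fixes a :: "'k \<Rightarrow> 'i \<Rightarrow> real"
  assumes "finite K"
  shows "\<exists>c. \<forall>k\<in>K. (\<Sum>i\<in>I. (b i - (\<Sum>j\<in>K. c j * a j i)) * a k i) = 0"
  using assms
proof (induction K arbitrary: b rule: finite_induct)
  case empty
  then show ?case by simp
next
  case (insert m K)
  obtain c where c: "\<And>k. k \<in> K \<Longrightarrow> (\<Sum>i\<in>I. (b i - (\<Sum>j\<in>K. c j * a j i)) * a k i) = 0"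
    using insert.IH by blast
  \<comment> \<open>Here the new regressor \<open>a m\<close> itself is the target, so
    \<open>p\<close> gives its projection onto the old regressors.\<close>
  obtain p where p: "\<And>k. k \<in> K \<Longrightarrow> (\<Sum>i\<in>I. (a m i - (\<Sum>j\<in>K. p j * a j i)) * a k i) = 0"
    using insert.IH by blast
  define e where "e i = b i - (\<Sum>j\<in>K. c j * a j i)" for i
  define r where "r i = a m i - (\<Sum>j\<in>K. p j * a j i)" for i
  \<comment> \<open>If \<open>r\<close> vanishes on \<open>I\<close>, then \<open>t = 0\<close> by the convention for division by zero, and this is the
    right choice.\<close>
  define t where "t = (\<Sum>i\<in>I. e i * r i) / (\<Sum>i\<in>I. r i * r i)"
  \<comment> \<open>The coefficients of the old fit plus \<open>t * r\<close>, with \<open>r\<close>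
    expanded in the original regressors.\<close>
  define c' where "c' k = (if k = m then t else c k - t * p k)" for k
  have residual: "b i - (\<Sum>j\<in>insert m K. c' j * a j i) = e i - t * r i" for i
  proof -
    have "(\<Sum>j\<in>K. c' j * a j i) = (\<Sum>j\<in>K. c j * a j i - t * (p j * a j i))"
      using insert.hyps by (intro sum.cong) (auto simp: c'_def algebra_simps)
    then show ?thesis
      using insert.hyps
      by (simp add: c'_def e_def r_def sum_subtractf sum_distrib_left[symmetric] algebra_simps)
  qed
  have orth: "(\<Sum>i\<in>I. (e i - t * r i) * a k i) = 0" if "k \<in> K" for k
    using c[OF that] p[OF that]
    by (simp add: e_def[symmetric] r_def[symmetric] left_diff_distrib sum_subtractf mult.assoc
        sum_distrib_left[symmetric])
  have orth_r: "(\<Sum>i\<in>I. (e i - t * r i) * r i) = 0"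
  proof (cases "(\<Sum>i\<in>I. r i * r i) = 0")
    case True
    then have "r i * r i = 0" if "finite I" "i \<in> I" for i
      using that by (simp add: sum_nonneg_eq_0_iff)
    \<comment> \<open>For infinite \<open>I\<close> every sum is 0 by convention.\<close>
    then show ?thesis by (cases "finite I") auto
  next
    case False
    have "(\<Sum>i\<in>I. (e i - t * r i) * r i) = (\<Sum>i\<in>I. e i * r i) - t * (\<Sum>i\<in>I. r i * r i)"
      by (simp add: left_diff_distrib sum_subtractf mult.assoc sum_distrib_left)
    with False show ?thesis
      by (simp add: t_def)
  qed
  \<comment> \<open>\<open>a m\<close> is \<open>r\<close> plus a combination of the old regressors,
    and the new error is orthogonal to each of these.\<close>
  have "(\<Sum>i\<in>I. (e i - t * r i) * a m i)
      = (\<Sum>i\<in>I. (e i - t * r i) * r i) + (\<Sum>i\<in>I. \<Sum>j\<in>K. p j * ((e i - t * r i) * a j i))"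
  proof -
    have "s * a m i = s * r i + (\<Sum>j\<in>K. p j * (s * a j i))" for s i
      by (simp add: r_def right_diff_distrib sum_distrib_left mult.left_commute)
    then show ?thesis
      by (simp add: sum.distrib[symmetric])
  qed
  also have "(\<Sum>i\<in>I. \<Sum>j\<in>K. p j * ((e i - t * r i) * a j i)) = 0"
    using orth by (subst sum.swap) (simp add: sum_distrib_left[symmetric])
  finally have "(\<Sum>i\<in>I. (e i - t * r i) * a m i) = 0"
    using orth_r by simp
  with orth show ?case
    by (intro exI[of _ c']) (simp only: residual, blast)
qed

text \<open>Pythagoras: changing the coefficients adds to the error \<open>e\<close> a vector
  \<open>u\<close> in the span of the regressors. It is orthogonal to \<open>e\<close>, so the
  squared norm grows by that of \<open>u\<close>.\<close>

lemma normal_equations_imp_least_squares: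
  fixes a :: "'k \<Rightarrow> 'i \<Rightarrow> real"
  assumes "\<And>k. k \<in> K \<Longrightarrow> (\<Sum>i\<in>I. (b i - (\<Sum>j\<in>K. c j * a j i)) * a k i) = 0"
  shows "(\<Sum>i\<in>I. (b i - (\<Sum>j\<in>K. c j * a j i))\<^sup>2) \<le> (\<Sum>i\<in>I. (b i - (\<Sum>j\<in>K. c' j * a j i))\<^sup>2)"
proof -
  define e where "e i = b i - (\<Sum>j\<in>K. c j * a j i)" for i
  define u where "u i = (\<Sum>j\<in>K. (c j - c' j) * a j i)" for i
  have "(\<Sum>i\<in>I. e i * u i) = (\<Sum>j\<in>K. (c j - c' j) * (\<Sum>i\<in>I. e i * a j i))"
    unfolding u_def sum_distrib_left by (subst sum.swap) (simp add: mult.left_commute)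
  also have "\<dots> = 0"
    using assms by (simp add: e_def)
  finally have orth: "(\<Sum>i\<in>I. e i * u i) = 0" .
  have "b i - (\<Sum>j\<in>K. c' j * a j i) = e i + u i" for i
    by (simp add: e_def u_def left_diff_distrib sum_subtractf)
  then have "(\<Sum>i\<in>I. (b i - (\<Sum>j\<in>K. c' j * a j i))\<^sup>2)
      = (\<Sum>i\<in>I. (e i)\<^sup>2) + (\<Sum>i\<in>I. (u i)\<^sup>2) + 2 * (\<Sum>i\<in>I. e i * u i)"
    by (simp add: power2_sum sum.distrib sum_distrib_left mult.assoc)
  then show ?thesis
    using orth sum_nonneg[of I "\<lambda>i. (u i)\<^sup>2"] by (simp add: e_def)
qed

text \<open>The leading coordinate 1 turns the intercept into the coefficient of a regressor with
  index 0.\<close>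

lemma signed_residual_eq:
  assumes "d \<ge> 1" "x i 0 = 1"
  shows "signed_residual d x \<beta> i = x i d - (\<Sum>k\<in>{0..<d}. \<beta> k * x i k)"
  using assms by (simp add: signed_residual_def sum.atLeast_Suc_lessThan)

lemma LSS_eq: "LSS n d x \<beta> = (\<Sum>i\<in>{1..n}. (signed_residual d x \<beta> i)\<^sup>2)"
  by (simp add: LSS_def residual_def)

lemma LSS_minimizer_exists:
  assumes "d \<ge> 1" and "\<And>i. i \<in> {1..n} \<Longrightarrow> x i 0 = 1"
  shows "\<exists>\<beta>. LSS_minimizer n d x \<beta>"
proof -
  obtain c where c: "\<And>k. k \<in> {0..<d} \<Longrightarrow>
      (\<Sum>i\<in>{1..n}. (x i d - (\<Sum>j\<in>{0..<d}. c j * x i j)) * x i k) = 0"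
    using normal_equations_solvable[where K = "{0..<d}" and I = "{1..n}" and b = "\<lambda>i. x i d"
        and a = "\<lambda>k i. x i k"] by blast
  have eq: "LSS n d x \<beta> = (\<Sum>i\<in>{1..n}. (x i d - (\<Sum>k\<in>{0..<d}. \<beta> k * x i k))\<^sup>2)" for \<beta>
    unfolding LSS_eq using assms by (intro sum.cong) (simp_all add: signed_residual_eq)
  have "LSS n d x c \<le> LSS n d x \<beta>" for \<beta>
    unfolding eq by (rule normal_equations_imp_least_squares) (rule c)
  \<comment> \<open>\<open>params d\<close> demands extensional functions, which \<open>c\<close>
    need not be; only its values below \<open>d\<close> enter the criterion.\<close>
  moreover have "LSS n d x (restrict c {0..<d}) = LSS n d x c"
    unfolding eq by simp
  ultimately show ?thesis
    by (intro exI[of _ "restrict c {0..<d}"])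
      (simp add: LSS_minimizer_def is_arg_min_linorder params_def)
qed

text \<open>\<open>h\<close> chooses tight slacks: \<open>g (y, h y) = f y\<close>, and
  \<open>f y\<close> is at most \<open>f y'\<close>, hence at most \<open>g (y', z')\<close> at any
  feasible \<open>(y', z')\<close>.\<close>

lemma is_arg_min_lift:
  fixes f :: "'a \<Rightarrow> 'c::linorder"
  assumes "is_arg_min f P y"
    and "\<And>y z. F (y, z) \<Longrightarrow> P y \<and> f y \<le> g (y, z)"
    and "\<And>y. P y \<Longrightarrow> F (y, h y) \<and> g (y, h y) = f y"
  shows "is_arg_min g F (y, h y)"
  using assms unfolding is_arg_min_linorder by (metis order_trans surj_pair)

text \<open>Comparing with the tight point over any \<open>y'\<close> gives
  \<open>f y \<le> g (y, z) \<le> g (y', h y') = f y'\<close>; \<open>z\<close> need not be tight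
  itself.\<close>

lemma is_arg_min_project:
  fixes f :: "'a \<Rightarrow> 'c::linorder"
  assumes "is_arg_min g F (y, z)"
    and "\<And>y z. F (y, z) \<Longrightarrow> P y \<and> f y \<le> g (y, z)"
    and "\<And>y. P y \<Longrightarrow> F (y, h y) \<and> g (y, h y) = f y"
  shows "is_arg_min f P y"
  using assms unfolding is_arg_min_linorder by (metis order_trans)

lemma QP_feasible_imp:
  assumes "QP_feasible n d x (\<beta>, z)"
  shows "\<beta> \<in> params d \<and> LSS n d x \<beta> \<le> (\<Sum>i\<in>{1..n}. (z i)\<^sup>2)"
proof -
  have "(signed_residual d x \<beta> i)\<^sup>2 \<le> (z i)\<^sup>2" if "i \<in> {1..n}" for i
  proof -
    \<comment> \<open>Both constraints are needed here: squaring preserves an inequality only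
      between nonnegative numbers.\<close>
    have "\<bar>signed_residual d x \<beta> i\<bar> \<le> z i"
      using assms that by (auto simp: QP_feasible_def abs_le_iff)
    then show ?thesis
      using power_mono[of "\<bar>signed_residual d x \<beta> i\<bar>" "z i" 2] by simp
  qed
  then show ?thesis
    using assms by (auto simp: QP_feasible_def LSS_eq intro: sum_mono)
qed

lemma QP_feasible_tight:
  assumes "\<beta> \<in> params d"
  shows "QP_feasible n d x (\<beta>, restrict (residual d x \<beta>) {1..n})"
  using assms by (auto simp: QP_feasible_def residual_def)

lemma QP_optimal_tight:
  assumes "LSS_minimizer n d x \<beta>"
  shows "QP_optimal n d x (\<beta>, restrict (residual d x \<beta>) {1..n})"
  unfolding QP_optimal_def
  using assms[unfolded LSS_minimizer_def]
  by (rule is_arg_min_lift[where h = "\<lambda>\<beta>. restrict (residual d x \<beta>) {1..n}"])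
    (auto simp: LSS_def simp del: One_nat_def dest: QP_feasible_imp intro: QP_feasible_tight)

lemma QP_optimal_imp_LSS_minimizer:
  assumes "QP_optimal n d x (\<beta>, z)"
  shows "LSS_minimizer n d x \<beta>"
  unfolding LSS_minimizer_def
  using assms[unfolded QP_optimal_def]
  by (rule is_arg_min_project[where h = "\<lambda>\<beta>. restrict (residual d x \<beta>) {1..n}"])
    (auto simp: LSS_def simp del: One_nat_def dest: QP_feasible_imp intro: QP_feasible_tight)

text \<open>Each \<open>w i\<close> already bounds a square, whatever the sign of the residual, so
  summing the constraints suffices.\<close>

lemma SOCP_feasible_imp:
  assumes "SOCP_feasible n d x (\<beta>, w)"
  shows "\<beta> \<in> params d \<and> LSS n d x \<beta> \<le> (\<Sum>i\<in>{1..n}. w i)"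
  using assms by (auto simp: SOCP_feasible_def LSS_eq intro: sum_mono)

lemma SOCP_feasible_tight:
  assumes "\<beta> \<in> params d"
  shows "SOCP_feasible n d x (\<beta>, \<lambda>i\<in>{1..n}. (residual d x \<beta> i)\<^sup>2)"
  using assms by (auto simp: SOCP_feasible_def residual_def)

lemma SOCP_optimal_tight:
  assumes "LSS_minimizer n d x \<beta>"
  shows "SOCP_optimal n d x (\<beta>, \<lambda>i\<in>{1..n}. (residual d x \<beta> i)\<^sup>2)"
  unfolding SOCP_optimal_def
  using assms[unfolded LSS_minimizer_def]
  by (rule is_arg_min_lift[where h = "\<lambda>\<beta>. \<lambda>i\<in>{1..n}. (residual d x \<beta> i)\<^sup>2"])
    (auto simp: LSS_def simp del: One_nat_def dest: SOCP_feasible_imp intro: SOCP_feasible_tight)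

lemma SOCP_optimal_imp_LSS_minimizer:
  assumes "SOCP_optimal n d x (\<beta>, w)"
  shows "LSS_minimizer n d x \<beta>"
  unfolding LSS_minimizer_def
  using assms[unfolded SOCP_optimal_def]
  by (rule is_arg_min_project[where h = "\<lambda>\<beta>. \<lambda>i\<in>{1..n}. (residual d x \<beta> i)\<^sup>2"])
    (auto simp: LSS_def simp del: One_nat_def dest: SOCP_feasible_imp intro: SOCP_feasible_tight)

theorem theorem12:
  fixes n d :: nat and x :: "nat \<Rightarrow> nat \<Rightarrow> real"
  assumes "d \<ge> 1"
    and "\<And>i. i \<in> {1..n} \<Longrightarrow> x i \<in> {0..d} \<rightarrow>\<^sub>E UNIV"
    and "\<And>i. i \<in> {1..n} \<Longrightarrow> x i 0 = 1"
  shows "(\<exists>\<beta> z. QP_optimal n d x (\<beta>, z)) \<and>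
         (\<forall>\<beta> z. QP_optimal n d x (\<beta>, z) \<longrightarrow> LSS_minimizer n d x \<beta>) \<and>
         (\<exists>\<beta> w. SOCP_optimal n d x (\<beta>, w)) \<and>
         (\<forall>\<beta> w. SOCP_optimal n d x (\<beta>, w) \<longrightarrow> LSS_minimizer n d x \<beta>)"
  \<comment> \<open>Optimal points of both problems come from a least squares minimizer with tight
    slacks.\<close>
  using LSS_minimizer_exists[of d n x] assms(1,3) QP_optimal_tight QP_optimal_imp_LSS_minimizer
    SOCP_optimal_tight SOCP_optimal_imp_LSS_minimizer
  by blast

end
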